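(* Let $m=2$, $n=2p$, $X\in\mathcal X^n$, and let a distance metric $\delta$ on $\mathcal X$ be given. Let $$\|f\|=\|f\|_{\mathrm{lip}}=\sup_{x\ne x'}\frac{f(x)-f(x')}{\delta(x,x')}.$$ Then the pure strategy optimal design (PSOD) for $X$ and $\|\cdot\|$ is optimal pairwise-matched allocation with respect to the pairwise distance metric $\delta$.
   Context: There are $n=2p$ subjects with covariates $X=(X_1,\dots,X_n)\in\mathcal X^n$ and two treatments. $\mathcal W$ is the set of assignments $W\in\{1,2\}^n$ with exactly $p$ subjects in each treatment; $u_i=+1$ if $W_i=1$ and $u_i=-1$ if $W_i=2$. For $f:\mathcal X\to\mathbb R$, $B(W,f)=\frac2n\sum_{i=1}^n u_i f(X_i)$. Given a magnitude function $\|\cdot\|$ on functions $\mathcal X\to\mathbb R$ with values in $\mathbb R\cup\{\infty\}$, set $M_{\mathrm P}^2(W)=\max_{\|f\|\le1}B^2(W,f)$. The PSOD draws $W$ uniformly at random from $\arg\min_{W\in\mathcal W}M_{\mathrm P}^2(W)$. Optimal pairwise-matched allocation: subjects are put into $n/2$ disjoint pairs (a perfect, non-bipartite matching of $\{1,\dots,n\}$) so as to minimize the sum of within-pair distances $\delta(X_i,X_j)$, and then each pair is split randomly between the two treatments. That is, $W$ is drawn uniformly at random from the set of assignments for which there is a minimum-total-distance perfect matching each of whose pairs has one subject in each treatment (when the optimal matching is unique, this means each pair is independently split by a fair coin). *)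

theory Defs
  imports "HOL-Probability.Probability"
begin

text \<open>Subjects are \<open>1, \<dots>, 2 * p\<close>, and \<open>X i\<close> is the covariate of subject \<open>i\<close>.
  Assignments are taken extensional, so that they form a finite set.\<close>

definition assignments :: "nat \<Rightarrow> (nat \<Rightarrow> nat) set" where
  "assignments p = {W \<in> {1..2 * p} \<rightarrow>\<^sub>E {1, 2}.
     card {i \<in> {1..2 * p}. W i = 1} = p \<and> card {i \<in> {1..2 * p}. W i = 2} = p}"

definition treatment_sign :: "(nat \<Rightarrow> nat) \<Rightarrow> nat \<Rightarrow> real" where
  "treatment_sign W i = (if W i = 1 then 1 else -1)"

definition imbalance :: "nat \<Rightarrow> (nat \<Rightarrow> 'a) \<Rightarrow> (nat \<Rightarrow> nat) \<Rightarrow> ('a \<Rightarrow> real) \<Rightarrow> real" where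
  "imbalance n X W f = 2 / real n * (\<Sum>i = 1..n. treatment_sign W i * f (X i))"

text \<open>The worst-case squared imbalance is a supremum in \<^typ>\<open>ereal\<close>, hence defined for every
  magnitude function \<open>N\<close>, whether or not the supremum is attained.\<close>

definition worst_imbalance_sq ::
    "nat \<Rightarrow> (nat \<Rightarrow> 'a) \<Rightarrow> (('a \<Rightarrow> real) \<Rightarrow> ereal) \<Rightarrow> (nat \<Rightarrow> nat) \<Rightarrow> ereal" where
  "worst_imbalance_sq n X N W = (SUP f \<in> {f. N f \<le> 1}. ereal ((imbalance n X W f)\<^sup>2))"

definition psod :: "nat \<Rightarrow> (nat \<Rightarrow> 'a) \<Rightarrow> (('a \<Rightarrow> real) \<Rightarrow> ereal) \<Rightarrow> (nat \<Rightarrow> nat) pmf" where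
  "psod p X N =
     pmf_of_set {W. is_arg_min (worst_imbalance_sq (2 * p) X N) (\<lambda>W. W \<in> assignments p) W}"

text \<open>Exchanging \<open>x\<close> and \<open>x'\<close> negates the difference quotient, so the supremum is nonnegative
  as soon as \<open>S\<close> has two points. The \<open>max 0\<close> only matters when \<open>S\<close> has at most one point:
  the supremum over no pairs is then \<open>0\<close> rather than \<open>-\<infinity>\<close>.\<close>

definition lip_magnitude :: "'a set \<Rightarrow> ('a \<Rightarrow> 'a \<Rightarrow> real) \<Rightarrow> ('a \<Rightarrow> real) \<Rightarrow> ereal" where
  "lip_magnitude S \<delta> f =
     max 0 (SUP (x, x') \<in> {(x, x'). x \<in> S \<and> x' \<in> S \<and> x \<noteq> x'}. ereal ((f x - f x') / \<delta> x x'))"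

definition perfect_matching :: "nat \<Rightarrow> nat set set \<Rightarrow> bool" where
  "perfect_matching n P \<longleftrightarrow> partition_on {1..n} P \<and> (\<forall>e \<in> P. card e = 2)"

text \<open>A pair \<open>e = {i, j}\<close> with \<open>i < j\<close> has \<open>Min e = i\<close> and \<open>Max e = j\<close>; as \<open>\<delta>\<close> is symmetric,
  the order of the two subjects is immaterial.\<close>

definition matching_cost :: "(nat \<Rightarrow> 'a) \<Rightarrow> ('a \<Rightarrow> 'a \<Rightarrow> real) \<Rightarrow> nat set set \<Rightarrow> real" where
  "matching_cost X \<delta> P = (\<Sum>e \<in> P. \<delta> (X (Min e)) (X (Max e)))"

definition optimal_matching ::
    "nat \<Rightarrow> (nat \<Rightarrow> 'a) \<Rightarrow> ('a \<Rightarrow> 'a \<Rightarrow> real) \<Rightarrow> nat set set \<Rightarrow> bool" where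
  "optimal_matching n X \<delta> = is_arg_min (matching_cost X \<delta>) (perfect_matching n)"

definition matched_allocation ::
    "nat \<Rightarrow> (nat \<Rightarrow> 'a) \<Rightarrow> ('a \<Rightarrow> 'a \<Rightarrow> real) \<Rightarrow> (nat \<Rightarrow> nat) pmf" where
  "matched_allocation p X \<delta> =
     pmf_of_set {W \<in> assignments p. \<exists>P. optimal_matching (2 * p) X \<delta> P \<and> (\<forall>e \<in> P. W ` e = {1, 2})}"

end

theory Submission
  imports Defs "HOL-Combinatorics.Cycles"
begin

text \<open>
  With \<open>n = 2 p\<close>, the imbalance of an assignment \<open>W\<close> against \<open>f\<close> is \<open>2 / n\<close> times the difference
  between the sums of \<open>f\<close> over the two treatment groups, and the magnitude of \<open>f\<close> is at most \<open>1\<close>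
  exactly when \<open>f x - f y \<le> \<delta> x y\<close> for all points of \<open>S\<close>. The supremum of
  the difference over such \<open>f\<close> is a Kantorovich dual: it equals the least total distance of a bijection between the two groups. Such
  a bijection is the same thing as a perfect matching all of whose pairs are split by \<open>W\<close>.

  One half of the duality is immediate. If \<open>W\<close> splits the matching \<open>P\<close>, the signed sum of \<open>f\<close>
  regroups over the pairs of \<open>P\<close>, and each pair contributes at most its distance
  (\<open>abs_signed_sum_le_matching_cost\<close>). For the other half, a cheapest bijection \<open>\<sigma>\<close> admits no
  improvement by permuting partners, so the weights
  \<open>\<delta> (X a) (X (\<sigma> b)) - \<delta> (X a) (X (\<sigma> a))\<close> have no negative cycle. Shortest-path costs then give a
  potential (\<open>potential_exists\<close>), and the potential extends from the finitely many covariates to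
  a nonexpansive function on \<open>S\<close> for which every pair \<open>{a, \<sigma> a}\<close> attains its distance
  (\<open>optimal_bijection_certificate\<close>). This function is also a maximizer of the squared imbalance.

  Hence, for \<open>p > 0\<close>, the worst case of \<open>W\<close> is an increasing function of the cost of the
  cheapest matching split by \<open>W\<close>. Every perfect matching is split by some assignment
  (\<open>splitting_assignment_exists\<close>), so
  minimizing over \<open>W\<close> minimizes over all perfect matchings, and the minimizing assignments are
  those that split an optimal matching. Both designs are uniform on this common set.
\<close>

section \<open>Potentials for weights without negative cycles\<close>

fun path_cost :: "('b \<Rightarrow> 'b \<Rightarrow> real) \<Rightarrow> 'b list \<Rightarrow> real" where
  "path_cost w (x # y # zs) = w x y + path_cost w (y # zs)"
| "path_cost w _ = 0"

lemma path_cost_split: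
  "path_cost w (ys @ b # zs) = path_cost w (ys @ [b]) + path_cost w (b # zs)"
proof (induction ys)
  case (Cons a ys)
  then show ?case by (cases ys) auto
qed simp

lemma path_cost_snoc:
  assumes "xs \<noteq> []"
  shows "path_cost w (xs @ [b]) = path_cost w xs + w (last xs) b"
  using assms path_cost_split[of w _ _ "[b]"] by (cases xs rule: rev_cases) auto

lemma path_cost_map2: "path_cost w (x # xs @ [c]) = sum_list (map2 w (x # xs) (xs @ [c]))"
  by (induction xs arbitrary: x) auto

text \<open>The permutation that rotates the vertices of a simple closed path pays, over the vertices of
  the path, exactly the weights of its edges. Thus a condition on all permutations becomes one on
  all simple cycles.\<close>

lemma closed_path_cost_eq_permutation_cost:
  assumes "distinct (b # zs)"
  shows "path_cost w (b # zs @ [b])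
    = (\<Sum>a\<in>set (b # zs). w a (cycle_of_list (b # zs) a))"
proof -
  let ?cs = "b # zs"
  have "path_cost w (b # zs @ [b]) = sum_list (map2 w ?cs (rotate1 ?cs))"
    by (simp only: path_cost_map2 rotate1.simps)
  also have "rotate1 ?cs = map (cycle_of_list ?cs) ?cs"
    using cyclic_rotation[OF assms, of 1] by (simp del: cycle_of_list.simps)
  also have "map2 w ?cs (map (cycle_of_list ?cs) ?cs) = map (\<lambda>a. w a (cycle_of_list ?cs a)) ?cs"
    by (simp only: map2_map_map[of _ "\<lambda>x. x", simplified] map_map comp_def)
  also have "sum_list \<dots> = (\<Sum>a\<in>set ?cs. w a (cycle_of_list ?cs a))"
    by (rule sum_list_distinct_conv_sum_set[OF assms])
  finally show ?thesis .
qed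

text \<open>The potential of \<open>a\<close> is the least cost of a path that ends in \<open>a\<close>, from any starting point.
  Only paths without repeated vertices are admitted, so that the minimum ranges over a finite set.
  Extending a path by a vertex that it already visits closes a cycle; as the cycle has nonnegative
  cost, it can be cut off.\<close>

lemma potential_exists:
  fixes w :: "'b \<Rightarrow> 'b \<Rightarrow> real"
  assumes fin: "finite A"
    and diag: "\<And>a. a \<in> A \<Longrightarrow> w a a = 0"
    and perm: "\<And>\<pi>. \<pi> permutes A \<Longrightarrow> 0 \<le> (\<Sum>a\<in>A. w a (\<pi> a))"
  shows "\<exists>u. \<forall>a\<in>A. \<forall>b\<in>A. u b \<le> u a + w a b"
proof -
  define L where "L a = {xs. distinct xs \<and> set xs \<subseteq> A \<and> xs \<noteq> [] \<and> last xs = a}" for a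
  define u where "u a = Min (path_cost w ` L a)" for a
  have finL: "finite (L a)" for a
    by (rule finite_subset[OF _ finite_subset_distinct[OF fin]]) (auto simp: L_def)
  have u_le: "u a \<le> path_cost w xs" if "xs \<in> L a" for a xs
    unfolding u_def using that finL by (intro Min_le) auto
  have u_ex: "\<exists>xs\<in>L a. u a = path_cost w xs" if "a \<in> A" for a
  proof -
    have "[a] \<in> L a" using that by (simp add: L_def)
    then have "u a \<in> path_cost w ` L a" unfolding u_def using finL by (intro Min_in) auto
    then show ?thesis by auto
  qed
  have cycle_nonneg: "0 \<le> path_cost w (b # zs @ [b])"
    if "distinct (b # zs)" "set (b # zs) \<subseteq> A" for b zs
  proof -
    let ?\<pi> = "cycle_of_list (b # zs)"
    \<comment> \<open>Vertices off the cycle are fixed points, which cost nothing.\<close>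
    have "0 \<le> (\<Sum>a\<in>A. w a (?\<pi> a))"
      using perm permutes_subset[OF cycle_permutes that(2)] by blast
    also have "\<dots> = (\<Sum>a\<in>set (b # zs). w a (?\<pi> a))"
      using fin that(2) diag
      by (intro sum.mono_neutral_right) (auto simp: id_outside_supp simp del: cycle_of_list.simps)
    also have "\<dots> = path_cost w (b # zs @ [b])"
      by (rule closed_path_cost_eq_permutation_cost[OF that(1), symmetric])
    finally show ?thesis .
  qed
  have "u b \<le> u a + w a b" if a: "a \<in> A" and b: "b \<in> A" for a b
  proof -
    obtain xs where xs: "xs \<in> L a" "u a = path_cost w xs" using u_ex[OF a] by auto
    have snoc: "path_cost w (xs @ [b]) = u a + w a b"
      using xs path_cost_snoc[of xs w b] by (simp add: L_def)
    show ?thesis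
    proof (cases "b \<in> set xs")
      case False
      then have "xs @ [b] \<in> L b" using xs b by (simp add: L_def)
      then show ?thesis using u_le snoc by fastforce
    next
      case True
      then obtain ys zs where split: "xs = ys @ b # zs" by (auto simp: in_set_conv_decomp)
      have "ys @ [b] \<in> L b" using xs split by (auto simp: L_def)
      moreover have "0 \<le> path_cost w (b # zs @ [b])"
        using cycle_nonneg[of b zs] xs split by (auto simp: L_def)
      moreover have "path_cost w (xs @ [b]) = path_cost w (ys @ [b]) + path_cost w (b # zs @ [b])"
        using path_cost_split[of w ys b "zs @ [b]"] split by simp
      ultimately show ?thesis using u_le[of "ys @ [b]" b] snoc by linarith
    qed
  qed
  then show ?thesis by blast
qed

section \<open>Duality for the assignment problem\<close>

text \<open>The condition is written without the quotient of \<^const>\<open>lip_magnitude\<close>, which makes it uniform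
  in \<open>x = y\<close>, and it constrains \<open>f\<close> on \<open>S\<close> only.\<close>

definition nonexpansive :: "'a set \<Rightarrow> ('a \<Rightarrow> 'a \<Rightarrow> real) \<Rightarrow> ('a \<Rightarrow> real) \<Rightarrow> bool" where
  "nonexpansive S \<delta> f \<longleftrightarrow> (\<forall>x\<in>S. \<forall>y\<in>S. f x - f y \<le> \<delta> x y)"

lemma lip_magnitude_le_1_iff:
  assumes "Metric_space S \<delta>"
  shows "lip_magnitude S \<delta> f \<le> 1 \<longleftrightarrow> nonexpansive S \<delta> f"
proof -
  interpret Metric_space S \<delta> by fact
  have quot: "(f x - f y) / \<delta> x y \<le> 1 \<longleftrightarrow> f x - f y \<le> \<delta> x y" if "x \<in> S" "y \<in> S" "x \<noteq> y" for x y
    using mdist_pos_less[of x y] that by (simp add: divide_le_eq)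
  have "lip_magnitude S \<delta> f \<le> 1
    \<longleftrightarrow> (\<forall>x\<in>S. \<forall>y\<in>S. x \<noteq> y \<longrightarrow> (f x - f y) / \<delta> x y \<le> 1)"
    unfolding lip_magnitude_def by (auto simp: SUP_le_iff)
  also have "\<dots> \<longleftrightarrow> nonexpansive S \<delta> f"
    unfolding nonexpansive_def using quot by (metis diff_self nonneg)
  finally show ?thesis .
qed

text \<open>Complementary slackness: a cheapest bijection is certified by a nonexpansive \<open>f\<close> that is tight
  on all its pairs. From a potential \<open>u\<close> on \<open>A\<close>, the values \<open>- u a\<close> are prescribed at \<open>Y (\<sigma> a)\<close>, and
  hence \<open>\<delta> (Y a) (Y (\<sigma> a)) - u a\<close> at \<open>Y a\<close>. For nonempty \<open>A\<close>, \<open>f\<close> is on \<open>S\<close> the least nonexpansive function that is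
  at least these values at the points \<open>Y a\<close>; the potential inequality says that it does not exceed
  the values prescribed at the points \<open>Y (\<sigma> a)\<close>. The map \<open>Y\<close> may identify indices, since different
  subjects may share a covariate.\<close>

lemma optimal_bijection_certificate:
  fixes Y :: "'b \<Rightarrow> 'a"
  assumes "Metric_space S \<delta>"
    and fin: "finite A"
    and YA: "Y ` A \<subseteq> S" and YB: "Y ` B \<subseteq> S"
    and \<sigma>: "bij_betw \<sigma> A B"
    and opt: "\<And>\<tau>. bij_betw \<tau> A B \<Longrightarrow>
      (\<Sum>a\<in>A. \<delta> (Y a) (Y (\<sigma> a))) \<le> (\<Sum>a\<in>A. \<delta> (Y a) (Y (\<tau> a)))"
  shows "\<exists>f. nonexpansive S \<delta> f \<and> (\<forall>a\<in>A. f (Y a) - f (Y (\<sigma> a)) = \<delta> (Y a) (Y (\<sigma> a)))"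
proof -
  interpret Metric_space S \<delta> by fact
  define c where "c a b = \<delta> (Y a) (Y b)" for a b
  define w where "w a a' = c a (\<sigma> a') - c a (\<sigma> a)" for a a'
  have "\<exists>u. \<forall>a\<in>A. \<forall>b\<in>A. u b \<le> u a + w a b"
  proof (rule potential_exists[OF fin])
    show "w a a = 0" if "a \<in> A" for a by (simp add: w_def)
    show "0 \<le> (\<Sum>a\<in>A. w a (\<pi> a))" if "\<pi> permutes A" for \<pi>
      using opt[OF bij_betw_trans[OF permutes_imp_bij[OF that] \<sigma>]]
      by (simp add: w_def c_def sum_subtractf)
  qed
  then obtain u where u: "u b \<le> u a + w a b" if "a \<in> A" "b \<in> A" for a b by blast
  have S: "Y a \<in> S" "Y (\<sigma> a) \<in> S" if "a \<in> A" for a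
    using that YA YB bij_betwE[OF \<sigma>] by auto
  show ?thesis
  proof (cases "A = {}")
    case True
    have "nonexpansive S \<delta> (\<lambda>_. 0)" by (simp add: nonexpansive_def)
    with True show ?thesis by blast
  next
    case False
    define g where "g x a = c a (\<sigma> a) - u a - \<delta> x (Y a)" for x a
    define f where "f x = Max (g x ` A)" for x
    have ge: "g x a \<le> f x" if "a \<in> A" for x a
      unfolding f_def using that fin by (intro Max_ge) auto
    have le: "f x \<le> t" if "\<And>a. a \<in> A \<Longrightarrow> g x a \<le> t" for x t
      unfolding f_def using that fin False by (intro Max.boundedI) auto
    have lip: "f x - f y \<le> \<delta> x y" if "x \<in> S" "y \<in> S" for x y
    proof -
      have "f x \<le> f y + \<delta> x y"
      proof (rule le)
        fix a assume a: "a \<in> A"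
        have "\<delta> y (Y a) \<le> \<delta> x y + \<delta> x (Y a)"
          using triangle[of y x "Y a"] commute[of x y] that S[OF a] by simp
        then show "g x a \<le> f y + \<delta> x y" using ge[OF a, of y] by (simp add: g_def)
      qed
      then show ?thesis by simp
    qed
    have "f (Y a) - f (Y (\<sigma> a)) = \<delta> (Y a) (Y (\<sigma> a))" if a: "a \<in> A" for a
    proof (rule antisym)
      show "f (Y a) - f (Y (\<sigma> a)) \<le> \<delta> (Y a) (Y (\<sigma> a))" using lip S a by blast
      have "f (Y (\<sigma> a)) \<le> - u a"
      proof (rule le)
        fix b assume b: "b \<in> A"
        show "g (Y (\<sigma> a)) b \<le> - u a"
          using u[OF b a] commute[of "Y b"] by (simp add: g_def w_def c_def)
      qed
      moreover have "c a (\<sigma> a) - u a \<le> f (Y a)"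
        using ge[OF a, of "Y a"] S[OF a] by (simp add: g_def)
      ultimately show "\<delta> (Y a) (Y (\<sigma> a)) \<le> f (Y a) - f (Y (\<sigma> a))" by (simp add: c_def)
    qed
    with lip show ?thesis by (auto simp: nonexpansive_def)
  qed
qed

text \<open>There may be infinitely many bijections as functions on the whole type; the hypothesis that the
  cost depends only on the values on \<open>A\<close> reduces the search to the finitely many extensional
  ones.\<close>

lemma minimal_bijection_exists:
  fixes cost :: "('b \<Rightarrow> 'c) \<Rightarrow> real"
  assumes fin: "finite A" "finite B" and card: "card A = card B"
    and cong: "\<And>\<sigma> \<tau>. (\<And>a. a \<in> A \<Longrightarrow> \<sigma> a = \<tau> a) \<Longrightarrow> cost \<sigma> = cost \<tau>"
  shows "\<exists>\<sigma>. bij_betw \<sigma> A B \<and> (\<forall>\<tau>. bij_betw \<tau> A B \<longrightarrow> cost \<sigma> \<le> cost \<tau>)"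
proof -
  define F where "F = {\<sigma> \<in> A \<rightarrow>\<^sub>E B. bij_betw \<sigma> A B}"
  have rest: "restrict \<tau> A \<in> F" if "bij_betw \<tau> A B" for \<tau>
  proof -
    have "bij_betw (restrict \<tau> A) A B"
      using that by (rule bij_betw_cong[THEN iffD1, rotated]) simp
    then show ?thesis using bij_betwE[OF that] by (auto simp: F_def)
  qed
  have "finite F" unfolding F_def using fin by (simp add: finite_PiE)
  moreover have "F \<noteq> {}" using finite_same_card_bij[OF fin card] rest by blast
  ultimately obtain \<sigma> where \<sigma>: "\<sigma> \<in> F" "\<And>\<tau>. \<tau> \<in> F \<Longrightarrow> cost \<sigma> \<le> cost \<tau>"
    using ex_is_arg_min_if_finite[of F cost] by (auto simp: is_arg_min_linorder)
  have "cost \<sigma> \<le> cost \<tau>" if "bij_betw \<tau> A B" for \<tau>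
  proof -
    have "cost \<tau> = cost (restrict \<tau> A)" by (rule cong) simp
    then show ?thesis using \<sigma>(2)[OF rest[OF that]] by simp
  qed
  with \<sigma>(1) show ?thesis by (auto simp: F_def)
qed

section \<open>Matchings split by an assignment\<close>

definition splits :: "(nat \<Rightarrow> nat) \<Rightarrow> nat set set \<Rightarrow> bool" where
  "splits W P \<longleftrightarrow> (\<forall>e\<in>P. W ` e = {1, 2})"

definition signed_sum :: "nat \<Rightarrow> (nat \<Rightarrow> 'a) \<Rightarrow> (nat \<Rightarrow> nat) \<Rightarrow> ('a \<Rightarrow> real) \<Rightarrow> real" where
  "signed_sum n X W f = (\<Sum>i = 1..n. treatment_sign W i * f (X i))"

lemma perfect_matching_pair:
  assumes "perfect_matching n P" "e \<in> P"
  shows "Min e < Max e" "e = {Min e, Max e}" "Min e \<in> {1..n}" "Max e \<in> {1..n}"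
proof -
  have e: "card e = 2" "e \<subseteq> {1..n}"
    using assms by (auto simp: perfect_matching_def dest!: partition_onD1)
  then obtain x y where xy: "e = {x, y}" "x < y"
    unfolding card_2_iff by (metis insert_commute linorder_neq_iff)
  then have "Min e = x" "Max e = y" by auto
  then show "Min e < Max e" "e = {Min e, Max e}" "Min e \<in> {1..n}" "Max e \<in> {1..n}"
    using xy e by auto
qed

lemma perfect_matching_sum:
  assumes "perfect_matching n P"
  shows "(\<Sum>i = 1..n. g i) = (\<Sum>e\<in>P. sum g e)"
proof -
  have part: "partition_on {1..n} P" using assms by (simp add: perfect_matching_def)
  have "sum g (\<Union>P) = (\<Sum>e\<in>P. sum g e)"
  proof -
    have "\<forall>e\<in>P. finite e" using partition_onD1[OF part]
      by (metis Union_upper finite_atLeastAtMost finite_subset)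
    moreover have "\<forall>e\<in>P. \<forall>e'\<in>P. e \<noteq> e' \<longrightarrow> e \<inter> e' = {}"
      using partition_onD2[OF part] by (auto simp: pairwise_def disjnt_def)
    ultimately show ?thesis by (simp add: sum.Union_disjoint)
  qed
  then show ?thesis using partition_onD1[OF part] by simp
qed

text \<open>Weak duality: in a pair that \<open>W\<close> splits, the two signs are opposite, so the pair contributes a
  difference of two values of \<open>f\<close>.\<close>

lemma abs_signed_sum_le_matching_cost:
  assumes M: "Metric_space S \<delta>" and X: "X ` {1..n} \<subseteq> S"
    and P: "perfect_matching n P" "splits W P" and f: "nonexpansive S \<delta> f"
  shows "\<bar>signed_sum n X W f\<bar> \<le> matching_cost X \<delta> P"
proof -
  interpret Metric_space S \<delta> by fact
  have "\<bar>\<Sum>i\<in>e. treatment_sign W i * f (X i)\<bar> \<le> \<delta> (X (Min e)) (X (Max e))" if e: "e \<in> P" for e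
  proof -
    define i j where "i = Min e" and "j = Max e"
    have ij: "e = {i, j}" "i \<noteq> j" "X i \<in> S" "X j \<in> S"
      using perfect_matching_pair[OF P(1) e] X unfolding i_def j_def by auto
    have "W ` e = {1, 2}" using P(2) e by (simp add: splits_def)
    then have "{W i, W j} = {1, 2}" using ij(1) by simp
    then have "treatment_sign W i = - treatment_sign W j" "\<bar>treatment_sign W j\<bar> = 1"
      by (auto simp: treatment_sign_def doubleton_eq_iff)
    then have "\<bar>\<Sum>i\<in>e. treatment_sign W i * f (X i)\<bar> = \<bar>f (X i) - f (X j)\<bar>"
      using ij(1,2) by (cases "W j = 1") (auto simp: treatment_sign_def split: if_splits)
    also have "\<dots> \<le> \<delta> (X i) (X j)"
    proof -
      have "f (X i) - f (X j) \<le> \<delta> (X i) (X j)" "f (X j) - f (X i) \<le> \<delta> (X j) (X i)"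
        using f ij(3,4) by (simp_all add: nonexpansive_def)
      then show ?thesis using commute[of "X j" "X i"] by linarith
    qed
    finally show ?thesis by (simp add: i_def j_def)
  qed
  then show ?thesis
    unfolding signed_sum_def perfect_matching_sum[OF P(1)] matching_cost_def
    by (rule order_trans[OF sum_abs sum_mono])
qed

lemma perfect_matching_of_bijection:
  assumes part: "A \<union> B = {1..n}" "A \<inter> B = {}" and \<sigma>: "bij_betw \<sigma> A B"
  shows "perfect_matching n ((\<lambda>a. {a, \<sigma> a}) ` A)"
proof -
  have img: "\<sigma> ` A = B" and inj: "inj_on \<sigma> A" using \<sigma> by (auto simp: bij_betw_def)
  have notin: "\<sigma> a \<notin> A" if "a \<in> A" for a using that img part by auto
  have "partition_on {1..n} ((\<lambda>a. {a, \<sigma> a}) ` A)"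
  proof (rule partition_onI)
    show "\<Union>((\<lambda>a. {a, \<sigma> a}) ` A) = {1..n}" using img part by auto
    fix p q assume "p \<in> (\<lambda>a. {a, \<sigma> a}) ` A" "q \<in> (\<lambda>a. {a, \<sigma> a}) ` A" "p \<noteq> q"
    then obtain a b where "p = {a, \<sigma> a}" "q = {b, \<sigma> b}" "a \<in> A" "b \<in> A" "a \<noteq> b" by auto
    then show "disjnt p q" using notin inj by (auto simp: disjnt_def dest: inj_onD)
  qed auto
  moreover have "card {a, \<sigma> a} = 2" if "a \<in> A" for a
    using that notin[OF that] by (metis card_2_iff)
  ultimately show ?thesis by (auto simp: perfect_matching_def)
qed

lemma matching_cost_of_bijection:
  assumes sym: "\<And>x y. \<delta> x y = \<delta> y x" and \<sigma>: "\<And>a. a \<in> A \<Longrightarrow> \<sigma> a \<notin> A"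
  shows "matching_cost X \<delta> ((\<lambda>a. {a, \<sigma> a}) ` A) = (\<Sum>a\<in>A. \<delta> (X a) (X (\<sigma> a)))"
proof -
  have "inj_on (\<lambda>a. {a, \<sigma> a}) A"
    using \<sigma> by (auto simp: inj_on_def doubleton_eq_iff)
  then have "matching_cost X \<delta> ((\<lambda>a. {a, \<sigma> a}) ` A)
    = (\<Sum>a\<in>A. \<delta> (X (Min {a, \<sigma> a})) (X (Max {a, \<sigma> a})))"
    by (simp add: matching_cost_def sum.reindex comp_def)
  also have "\<dots> = (\<Sum>a\<in>A. \<delta> (X a) (X (\<sigma> a)))"
    using sym by (intro sum.cong) (auto simp: min_def max_def)
  finally show ?thesis .
qed

text \<open>Strong duality, by applying the certificate to a cheapest bijection from the first treatment
  group to the second. By weak duality \<open>P\<close> is then cheapest among all matchings that \<open>W\<close> splits, and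
  \<open>f\<close> has the largest signed sum in absolute value.\<close>

lemma split_matching_certificate:
  assumes M: "Metric_space S \<delta>" and X: "X ` {1..2 * p} \<subseteq> S" and W: "W \<in> assignments p"
  shows "\<exists>P f. perfect_matching (2 * p) P \<and> splits W P \<and> nonexpansive S \<delta> f
    \<and> signed_sum (2 * p) X W f = matching_cost X \<delta> P"
proof -
  interpret Metric_space S \<delta> by fact
  define A where "A = {i \<in> {1..2 * p}. W i = 1}"
  define B where "B = {i \<in> {1..2 * p}. W i = 2}"
  have AB: "A \<union> B = {1..2 * p}" "A \<inter> B = {}" "card A = card B"
    using W by (auto simp: assignments_def A_def B_def PiE_iff)
  have fin: "finite A" "finite B" by (auto simp: A_def B_def)
  obtain \<sigma> where \<sigma>: "bij_betw \<sigma> A B"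
    and opt: "\<And>\<tau>. bij_betw \<tau> A B \<Longrightarrow>
      (\<Sum>a\<in>A. \<delta> (X a) (X (\<sigma> a))) \<le> (\<Sum>a\<in>A. \<delta> (X a) (X (\<tau> a)))"
    using minimal_bijection_exists[OF fin AB(3), of "\<lambda>\<tau>. \<Sum>a\<in>A. \<delta> (X a) (X (\<tau> a))"] by auto
  have "X ` A \<subseteq> S" "X ` B \<subseteq> S" using X by (auto simp: A_def B_def)
  from optimal_bijection_certificate[OF M fin(1) this \<sigma> opt]
  obtain f where f: "nonexpansive S \<delta> f"
    and tight: "\<And>a. a \<in> A \<Longrightarrow> f (X a) - f (X (\<sigma> a)) = \<delta> (X a) (X (\<sigma> a))" by blast
  define P where "P = (\<lambda>a. {a, \<sigma> a}) ` A"
  have \<sigma>B: "\<sigma> a \<in> B" if "a \<in> A" for a using bij_betwE[OF \<sigma>] that by blast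
  have "signed_sum (2 * p) X W f
    = (\<Sum>i\<in>A. treatment_sign W i * f (X i)) + (\<Sum>i\<in>B. treatment_sign W i * f (X i))"
    unfolding signed_sum_def AB(1)[symmetric] using fin AB(2) by (rule sum.union_disjoint)
  also have "\<dots> = (\<Sum>i\<in>A. f (X i)) - (\<Sum>i\<in>B. f (X i))"
    by (simp add: A_def B_def treatment_sign_def sum_negf)
  also have "(\<Sum>i\<in>B. f (X i)) = (\<Sum>a\<in>A. f (X (\<sigma> a)))"
    by (rule sum.reindex_bij_betw[OF \<sigma>, symmetric])
  also have "(\<Sum>i\<in>A. f (X i)) - \<dots> = (\<Sum>a\<in>A. \<delta> (X a) (X (\<sigma> a)))"
    using tight by (simp flip: sum_subtractf)
  also have "\<dots> = matching_cost X \<delta> P"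
    unfolding P_def using \<sigma>B AB(2)
    by (intro matching_cost_of_bijection[symmetric] commute) auto
  finally have "signed_sum (2 * p) X W f = matching_cost X \<delta> P" .
  moreover have "perfect_matching (2 * p) P"
    unfolding P_def by (rule perfect_matching_of_bijection[OF AB(1,2) \<sigma>])
  moreover have "splits W P" using \<sigma>B by (auto simp: splits_def P_def A_def B_def)
  ultimately show ?thesis using f by blast
qed

text \<open>Giving treatment 1 to the smaller subject of each pair splits the matching, and the groups have
  equal size because every pair contributes one subject to each.\<close>

lemma splitting_assignment_exists:
  assumes P: "perfect_matching (2 * p) P"
  shows "\<exists>W\<in>assignments p. splits W P"
proof -
  have part: "partition_on {1..2 * p} P" using P by (simp add: perfect_matching_def)
  have disj: "e = e'" if "e \<in> P" "e' \<in> P" "i \<in> e" "i \<in> e'" for e e' i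
    using partition_onD2[OF part] that by (auto simp: pairwise_def disjnt_def)
  have Min_in: "Min e \<in> e" "Max e \<in> e" if "e \<in> P" for e
    using perfect_matching_pair(2)[OF P that] by blast+
  have "2 * p = (\<Sum>e\<in>P. card e)"
    using perfect_matching_sum[OF P, of "\<lambda>_. 1::nat"] by simp
  also have "\<dots> = 2 * card P" using P by (simp add: perfect_matching_def)
  finally have card: "card P = p" by simp
  define W where "W = (\<lambda>i\<in>{1..2 * p}. if i \<in> Min ` P then 1 else 2 :: nat)"
  have sub: "Min ` P \<subseteq> {1..2 * p}" using perfect_matching_pair(3)[OF P] by blast
  have "inj_on Min P" using disj Min_in by (metis inj_onI)
  then have cardM: "card (Min ` P) = p" using card by (simp add: card_image)
  have one: "{i \<in> {1..2 * p}. W i = 1} = Min ` P"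
    and two: "{i \<in> {1..2 * p}. W i = 2} = {1..2 * p} - Min ` P"
    using sub by (auto simp: W_def)
  have "W \<in> assignments p"
    unfolding assignments_def mem_Collect_eq one two
    using cardM sub by (auto simp: W_def card_Diff_subset finite_subset)
  moreover have "splits W P"
    unfolding splits_def
  proof
    fix e assume e: "e \<in> P"
    have "Max e \<notin> Min ` P"
    proof
      assume "Max e \<in> Min ` P"
      then obtain e' where "e' \<in> P" "Max e = Min e'" by auto
      then have "e = e'" using disj[OF e] Min_in e by metis
      with \<open>Max e = Min e'\<close> show False using perfect_matching_pair(1)[OF P e] by simp
    qed
    then have "W (Min e) = 1" "W (Max e) = 2"
      using perfect_matching_pair(3,4)[OF P e] e by (auto simp: W_def)
    moreover have "W ` e = {W (Min e), W (Max e)}"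
      by (subst perfect_matching_pair(2)[OF P e]) simp
    ultimately show "W ` e = {1, 2}" by simp
  qed
  ultimately show ?thesis by blast
qed

section \<open>Worst-case imbalance and optimal matchings\<close>

lemma worst_imbalance_eq_matching_cost:
  assumes M: "Metric_space S \<delta>" and X: "X ` {1..n} \<subseteq> S"
    and P: "perfect_matching n P" "splits W P"
    and f: "nonexpansive S \<delta> f" "signed_sum n X W f = matching_cost X \<delta> P"
  shows "worst_imbalance_sq n X (lip_magnitude S \<delta>) W = ereal ((imbalance n X W f)\<^sup>2)"
proof -
  have imb: "imbalance n X W g = 2 / real n * signed_sum n X W g" for g
    by (simp add: imbalance_def signed_sum_def)
  have "(imbalance n X W g)\<^sup>2 \<le> (imbalance n X W f)\<^sup>2" if "nonexpansive S \<delta> g" for g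
  proof -
    have "\<bar>signed_sum n X W g\<bar> \<le> \<bar>signed_sum n X W f\<bar>"
      using abs_signed_sum_le_matching_cost[OF M X P that] f(2) by simp
    then have "\<bar>imbalance n X W g\<bar> \<le> \<bar>imbalance n X W f\<bar>"
      unfolding imb abs_mult by (intro mult_left_mono) auto
    then show ?thesis by (simp add: abs_le_square_iff)
  qed
  then show ?thesis
    unfolding worst_imbalance_sq_def using f(1)
    by (intro SUP_eqI) (auto simp: lip_magnitude_le_1_iff[OF M])
qed

text \<open>An assignment may split several matchings; only the cost of the cheapest of them determines
  its worst case. A minimizer is compared with an arbitrary matching \<open>Q\<close> through an
  assignment that splits \<open>Q\<close>.\<close>

lemma worst_imbalance_minimizer_iff_optimal_matching:
  assumes M: "Metric_space S \<delta>" and X: "X ` {1..2 * p} \<subseteq> S"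
  shows "is_arg_min (worst_imbalance_sq (2 * p) X (lip_magnitude S \<delta>)) (\<lambda>W. W \<in> assignments p) W
    \<longleftrightarrow> W \<in> assignments p \<and> (\<exists>P. optimal_matching (2 * p) X \<delta> P \<and> splits W P)"
    (is "is_arg_min ?worst _ _ \<longleftrightarrow> _")
proof -
  interpret Metric_space S \<delta> by fact
  let ?pm = "perfect_matching (2 * p)" and ?cost = "matching_cost X \<delta>"
  have cost_nonneg: "0 \<le> ?cost P" for P by (simp add: matching_cost_def sum_nonneg)
  have best: "\<exists>P. ?pm P \<and> splits V P
      \<and> ?worst V = ereal ((2 / real (2 * p) * ?cost P)\<^sup>2)
      \<and> (\<forall>Q. ?pm Q \<longrightarrow> splits V Q \<longrightarrow> ?cost P \<le> ?cost Q)"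
    if V: "V \<in> assignments p" for V
  proof -
    obtain P f where P: "?pm P" "splits V P"
      and f: "nonexpansive S \<delta> f" "signed_sum (2 * p) X V f = ?cost P"
      using split_matching_certificate[OF M X V] by blast
    have "?worst V = ereal ((2 / real (2 * p) * ?cost P)\<^sup>2)"
      using worst_imbalance_eq_matching_cost[OF M X P f] f(2)
      by (simp add: imbalance_def signed_sum_def)
    moreover have "?cost P \<le> ?cost Q" if "?pm Q" "splits V Q" for Q
      using abs_signed_sum_le_matching_cost[OF M X that f(1)] f(2) by simp
    ultimately show ?thesis using P by blast
  qed
  \<comment> \<open>For \<open>p = 0\<close> the factor \<open>2 / real (2 * p)\<close> is \<open>0\<close>, so costs cannot be recovered from
    the values; but then the empty matching is the only one.\<close>
  have le_iff: "ereal ((2 / real (2 * p) * ?cost P)\<^sup>2) \<le> ereal ((2 / real (2 * p) * ?cost Q)\<^sup>2)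
      \<longleftrightarrow> ?cost P \<le> ?cost Q" if PQ: "?pm P" "?pm Q" for P Q
  proof (cases "p = 0")
    case True
    then have "P = Q" using PQ by (simp add: perfect_matching_def partition_on_empty)
    then show ?thesis by simp
  next
    case False
    define k where "k = 2 / real (2 * p)"
    have k: "0 < k" using False by (simp add: k_def)
    have "(k * ?cost P)\<^sup>2 \<le> (k * ?cost Q)\<^sup>2 \<longleftrightarrow> k * ?cost P \<le> k * ?cost Q"
      using k cost_nonneg[of P] cost_nonneg[of Q] by (intro power_mono_iff) auto
    also have "\<dots> \<longleftrightarrow> ?cost P \<le> ?cost Q" using k by simp
    finally show ?thesis by (simp add: k_def)
  qed
  show ?thesis
  proof
    assume min: "is_arg_min ?worst (\<lambda>W. W \<in> assignments p) W"
    then have W: "W \<in> assignments p" by (simp add: is_arg_min_def)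
    obtain P where P: "?pm P" "splits W P" "?worst W = ereal ((2 / real (2 * p) * ?cost P)\<^sup>2)"
      using best[OF W] by blast
    have "?cost P \<le> ?cost Q" if Q: "?pm Q" for Q
    proof -
      obtain V where V: "V \<in> assignments p" "splits V Q"
        using splitting_assignment_exists[OF Q] by blast
      obtain R where R: "?pm R" "?worst V = ereal ((2 / real (2 * p) * ?cost R)\<^sup>2)"
        "?cost R \<le> ?cost Q"
        using best[OF V(1)] Q V(2) by blast
      have "?worst W \<le> ?worst V" using min V(1) by (simp add: is_arg_min_linorder)
      then have "?cost P \<le> ?cost R" using le_iff P R by simp
      with R(3) show ?thesis by simp
    qed
    with P have "optimal_matching (2 * p) X \<delta> P"
      by (simp add: optimal_matching_def is_arg_min_linorder)
    with W P(2) show "W \<in> assignments p \<and> (\<exists>P. optimal_matching (2 * p) X \<delta> P \<and> splits W P)"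
      by blast
  next
    assume "W \<in> assignments p \<and> (\<exists>P. optimal_matching (2 * p) X \<delta> P \<and> splits W P)"
    then obtain P where W: "W \<in> assignments p" and P: "?pm P" "splits W P"
      and opt: "\<And>Q. ?pm Q \<Longrightarrow> ?cost P \<le> ?cost Q"
      by (auto simp: optimal_matching_def is_arg_min_linorder)
    obtain R where R: "?pm R" "?worst W = ereal ((2 / real (2 * p) * ?cost R)\<^sup>2)"
      "?cost R \<le> ?cost P"
      using best[OF W] P by blast
    have "?worst W \<le> ?worst V" if V: "V \<in> assignments p" for V
    proof -
      obtain Q where Q: "?pm Q" "?worst V = ereal ((2 / real (2 * p) * ?cost Q)\<^sup>2)"
        using best[OF V] by blast
      then have "?cost R \<le> ?cost Q" using R(3) opt[OF Q(1)] by simp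
      then show ?thesis using le_iff[OF R(1) Q(1)] R(2) Q(2) by simp
    qed
    with W show "is_arg_min ?worst (\<lambda>W. W \<in> assignments p) W" by (simp add: is_arg_min_linorder)
  qed
qed

theorem theorem4:
  fixes S :: "'a set" and \<delta> :: "'a \<Rightarrow> 'a \<Rightarrow> real" and X :: "nat \<Rightarrow> 'a" and p :: nat
  assumes "Metric_space S \<delta>"
    and "\<And>i. i \<in> {1..2 * p} \<Longrightarrow> X i \<in> S"
  shows "(\<forall>W \<in> assignments p. \<exists>f. lip_magnitude S \<delta> f \<le> 1 \<and>
            worst_imbalance_sq (2 * p) X (lip_magnitude S \<delta>) W
              = ereal ((imbalance (2 * p) X W f)\<^sup>2)) \<and>
         psod p X (lip_magnitude S \<delta>) = matched_allocation p X \<delta>"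
proof (intro conjI ballI)
  have X: "X ` {1..2 * p} \<subseteq> S" using assms(2) by blast
  show "\<exists>f. lip_magnitude S \<delta> f \<le> 1 \<and>
      worst_imbalance_sq (2 * p) X (lip_magnitude S \<delta>) W = ereal ((imbalance (2 * p) X W f)\<^sup>2)"
    if W: "W \<in> assignments p" for W
  proof -
    obtain P f where "perfect_matching (2 * p) P" "splits W P"
      and f: "nonexpansive S \<delta> f" "signed_sum (2 * p) X W f = matching_cost X \<delta> P"
      using split_matching_certificate[OF assms(1) X W] by blast
    from worst_imbalance_eq_matching_cost[OF assms(1) X this] f(1)
    show ?thesis by (auto simp: lip_magnitude_le_1_iff[OF assms(1)])
  qed
  show "psod p X (lip_magnitude S \<delta>) = matched_allocation p X \<delta>"
    unfolding psod_def matched_allocation_def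
      worst_imbalance_minimizer_iff_optimal_matching[OF assms(1) X] splits_def ..
qed

end
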